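(* Assume periodic boundary conditions on the boundary $\partial\Omega$ of the bounded two-dimensional domain $\Omega\subset\mathbb{R}^2$. Then the semi-discrete (in time) scheme for the shallow water equations, which in non-dimensional form with Froude number $\varepsilon$ reads $$\eta^{n+1}-\frac{\Delta t^2}{\varepsilon^2}\,\nabla\cdot\left(H^n\nabla\eta^{n+1}\right)=\eta^n-\Delta t\,\nabla\cdot\mathbf{q}^*,\qquad \mathbf{q}^*=\mathbf{q}^n-\Delta t\,\nabla\cdot\left(\mathbf{v}^n\otimes\mathbf{q}^n\right),$$ $$\mathbf{q}^{n+1}=\mathbf{q}^*-\frac{\Delta t}{\varepsilon^2}\,H^n\,\nabla\eta^{n+1},$$ is, at the leading order of the asymptotic expansion in powers of $\varepsilon$ and in the asymptotic limit $\varepsilon\to 0$, a consistent approximation of the low Froude shallow water system $$\nabla\cdot\left((\eta_{(0)}-b)\,\mathbf{v}_{(0)}\right)=0,\qquad \partial_t\mathbf{q}_{(0)}+\nabla\cdot\left(\mathbf{v}_{(0)}\otimes\mathbf{q}_{(0)}\right)+(\eta_{(0)}-b)\,\nabla\eta_{(2)}=\mathbf{0}.$$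
   Context: The rescaled (non-dimensional) shallow water equations, with Strouhal number one and reference Froude number $\mathrm{Fr}=U_0/\sqrt{gH_0}=\varepsilon$ (characteristic velocity $U_0$, characteristic depth $H_0$, gravity acceleration $g$), are $$\partial_t\eta+\nabla\cdot\mathbf{q}=0,\qquad \partial_t\mathbf{q}+\nabla\cdot(\mathbf{v}\otimes\mathbf{q})+\frac{H}{\varepsilon^2}\nabla\eta=\mathbf{0},\qquad \partial_t b=0,$$ where $\eta(\mathbf{x},t)$ is the free surface elevation, $b=b(\mathbf{x})$ the prescribed, time-independent bottom bathymetry, $H=\eta-b$ the total water depth (no dry areas: $H>0$), $\mathbf{v}$ the velocity and $\mathbf{q}=H\mathbf{v}$ the discharge. A superscript $n$ denotes the approximation at time $t^n$, with time step $\Delta t=t^{n+1}-t^n$; space is kept continuous, $H^n=\eta^n-b$ and $\mathbf{q}^n=H^n\mathbf{v}^n$. The scheme is obtained by inserting the second equation into the first in $$\frac{\eta^{n+1}-\eta^n}{\Delta t}+\nabla\cdot\mathbf{q}^{n+1}=0,\qquad \frac{\mathbf{q}^{n+1}-\mathbf{q}^n}{\Delta t}+\nabla\cdot(\mathbf{v}^n\otimes\mathbf{q}^n)+\frac{H^n}{\varepsilon^2}\nabla\eta^{n+1}=\mathbf{0};$$ in dimensional variables $1/\varepsilon^2$ is replaced by $g$. A subscript $(k)$ denotes the coefficient of $\varepsilon^k$ in the formal expansion $\phi=\phi_{(0)}+\varepsilon\phi_{(1)}+\varepsilon^2\phi_{(2)}+\dots$ of a variable $\phi$. The low Froude shallow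 water system is the formal limit, as $\varepsilon\to0$, of the rescaled equations, obtained by inserting these expansions, collecting like powers of $\varepsilon$ and using periodic boundary conditions; in it $\eta_{(0)}$ is constant in space and time and $\mathbf{q}_{(0)}=(\eta_{(0)}-b)\,\mathbf{v}_{(0)}$. *)

theory Defs
  imports "HOL-Analysis.Analysis" "HOL-Computational_Algebra.Formal_Laurent_Series"
begin

section \<open>Periodic domains and functions\<close>

text \<open>
  A bounded domain with periodic boundary conditions is a bounded domain whose translates by the
  lattice spanned by two linearly independent periods tile the plane (for instance the open
  rectangle with sides the two periods).  Fields satisfying periodic boundary conditions are
  represented by their periodic extensions to the whole plane.
\<close>

definition lattice_vec :: "real^2 \<Rightarrow> real^2 \<Rightarrow> int \<Rightarrow> int \<Rightarrow> real^2" where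
  "lattice_vec a1 a2 m n = of_int m *\<^sub>R a1 + of_int n *\<^sub>R a2"

definition periodic_domain :: "real^2 \<Rightarrow> real^2 \<Rightarrow> (real^2) set \<Rightarrow> bool" where
  "periodic_domain a1 a2 \<Omega> \<longleftrightarrow>
     a1 \<noteq> a2 \<and> independent {a1, a2} \<and>
     open \<Omega> \<and> connected \<Omega> \<and> bounded \<Omega> \<and>
     (\<forall>m n. (m, n) \<noteq> (0, 0) \<longrightarrow> \<Omega> \<inter> (\<lambda>x. x + lattice_vec a1 a2 m n) ` \<Omega> = {}) \<and>
     (\<Union>m n. (\<lambda>x. x + lattice_vec a1 a2 m n) ` closure \<Omega>) = UNIV"

definition periodic :: "real^2 \<Rightarrow> real^2 \<Rightarrow> (real^2 \<Rightarrow> 'a) \<Rightarrow> bool" where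
  "periodic a1 a2 f \<longleftrightarrow> (\<forall>x. f (x + a1) = f x \<and> f (x + a2) = f x)"


section \<open>Differential operators\<close>

definition pd :: "2 \<Rightarrow> (real^2 \<Rightarrow> 'a::real_normed_vector) \<Rightarrow> real^2 \<Rightarrow> 'a" where
  "pd i f x = frechet_derivative f (at x) (axis i 1)"

primrec Ck :: "nat \<Rightarrow> (real^2 \<Rightarrow> 'a::real_normed_vector) \<Rightarrow> bool" where
  "Ck 0 f \<longleftrightarrow> continuous_on UNIV f"
| "Ck (Suc k) f \<longleftrightarrow> (\<forall>x. f differentiable (at x)) \<and> (\<forall>i. Ck k (pd i f))"

text \<open>
  A formal expansion in powers of the Froude number is a field with values in formal power
  series; a field with a vector value has such a series in each component.  Differentiation in
  space acts on the coefficients.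
\<close>

definition coef :: "nat \<Rightarrow> (real^2 \<Rightarrow> real fps) \<Rightarrow> real^2 \<Rightarrow> real" where
  "coef k \<phi> x = fps_nth (\<phi> x) k"

definition vcoef :: "nat \<Rightarrow> (real^2 \<Rightarrow> real fps ^ 2) \<Rightarrow> real^2 \<Rightarrow> real^2" where
  "vcoef k u x = (\<chi> i. fps_nth (u x $ i) k)"

definition fpd :: "2 \<Rightarrow> (real^2 \<Rightarrow> real fps) \<Rightarrow> real^2 \<Rightarrow> real fps" where
  "fpd i \<phi> x = Abs_fps (\<lambda>k. pd i (coef k \<phi>) x)"

text \<open>
  The following operators are used both for real fields, with partial derivatives \<open>D = pd\<close>, and
  for formal expansions, with \<open>D = fpd\<close>.
\<close>

definition grad :: "(2 \<Rightarrow> (real^2 \<Rightarrow> 'a) \<Rightarrow> real^2 \<Rightarrow> 'a) \<Rightarrow> (real^2 \<Rightarrow> 'a) \<Rightarrow> real^2 \<Rightarrow> 'a^2" where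
  "grad D f x = (\<chi> i. D i f x)"

definition divg ::
  "(2 \<Rightarrow> (real^2 \<Rightarrow> 'a::comm_monoid_add) \<Rightarrow> real^2 \<Rightarrow> 'a) \<Rightarrow> (real^2 \<Rightarrow> 'a^2) \<Rightarrow> real^2 \<Rightarrow> 'a" where
  "divg D u x = (\<Sum>i\<in>UNIV. D i (\<lambda>y. u y $ i) x)"

definition tensor :: "'a::times^2 \<Rightarrow> 'a^2 \<Rightarrow> 'a^2^2" where
  "tensor u w = (\<chi> i j. u $ i * w $ j)"

definition divt ::
  "(2 \<Rightarrow> (real^2 \<Rightarrow> 'a::comm_monoid_add) \<Rightarrow> real^2 \<Rightarrow> 'a) \<Rightarrow> (real^2 \<Rightarrow> 'a^2^2) \<Rightarrow> real^2 \<Rightarrow> 'a^2" where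
  "divt D A x = (\<chi> i. \<Sum>j\<in>UNIV. D j (\<lambda>y. A y $ i $ j) x)"


section \<open>The semi-discrete scheme for formal expansions\<close>

text \<open>The bathymetry \<open>b\<close> does not depend on the Froude number.\<close>

definition depth :: "(real^2 \<Rightarrow> real) \<Rightarrow> (real^2 \<Rightarrow> real fps) \<Rightarrow> real^2 \<Rightarrow> real fps" where
  "depth b \<eta> x = \<eta> x - fps_const (b x)"

definition discharge ::
  "(real^2 \<Rightarrow> real) \<Rightarrow> (real^2 \<Rightarrow> real fps) \<Rightarrow> (real^2 \<Rightarrow> real fps ^ 2) \<Rightarrow> real^2 \<Rightarrow> real fps ^ 2" where
  "discharge b \<eta> v x = depth b \<eta> x *s v x"

definition explicit_discharge ::
  "(real^2 \<Rightarrow> real) \<Rightarrow> real \<Rightarrow> (real^2 \<Rightarrow> real fps) \<Rightarrow> (real^2 \<Rightarrow> real fps ^ 2) \<Rightarrow> real^2 \<Rightarrow> real fps ^ 2"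
  where
  "explicit_discharge b dt \<eta> v x =
     discharge b \<eta> v x - fps_const dt *s divt fpd (\<lambda>y. tensor (v y) (discharge b \<eta> v y)) x"

definition vec_to_fls :: "real fps ^ 2 \<Rightarrow> real fls ^ 2" where
  "vec_to_fls u = (\<chi> i. fps_to_fls (u $ i))"

text \<open>
  One step, of length \<open>dt\<close>, from \<open>(\<eta>, v)\<close> to \<open>(\<eta>', v')\<close>.  The Froude number is the
  indeterminate \<open>fls_X\<close>, so that both equations are identities of formal Laurent series, i.e.
  they hold separately at each power of the Froude number.
\<close>

definition scheme_step ::
  "(real^2) set \<Rightarrow> (real^2 \<Rightarrow> real) \<Rightarrow> real \<Rightarrow> (real^2 \<Rightarrow> real fps) \<Rightarrow> (real^2 \<Rightarrow> real fps ^ 2) \<Rightarrow>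
   (real^2 \<Rightarrow> real fps) \<Rightarrow> (real^2 \<Rightarrow> real fps ^ 2) \<Rightarrow> bool" where
  "scheme_step \<Omega> b dt \<eta> v \<eta>' v' \<longleftrightarrow>
     (\<forall>x\<in>\<Omega>.
        fps_to_fls (\<eta>' x)
          - fls_const (dt^2) / fls_X^2
              * fps_to_fls (divg fpd (\<lambda>y. depth b \<eta> y *s grad fpd \<eta>' y) x)
        = fps_to_fls (\<eta> x) - fls_const dt * fps_to_fls (divg fpd (explicit_discharge b dt \<eta> v) x)
      \<and>
        vec_to_fls (discharge b \<eta>' v' x)
        = vec_to_fls (explicit_discharge b dt \<eta> v x)
            - (fls_const dt / fls_X^2) *s vec_to_fls (depth b \<eta> x *s grad fpd \<eta>' x))"


section \<open>The low Froude shallow water system\<close>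

text \<open>
  A state consists of the leading order velocity \<open>v\<close> and the second order elevation \<open>p\<close>; the
  constant \<open>c\<close> is the leading order elevation.
\<close>

type_synonym lf_state = "(real^2 \<Rightarrow> real^2) \<times> (real^2 \<Rightarrow> real)"

definition lf_discharge :: "(real^2 \<Rightarrow> real) \<Rightarrow> real \<Rightarrow> (real^2 \<Rightarrow> real^2) \<Rightarrow> real^2 \<Rightarrow> real^2" where
  "lf_discharge b c v x = (c - b x) *\<^sub>R v x"

text \<open>Classical solutions on \<open>\<Omega> \<times> [0, T]\<close>.\<close>

definition lf_solution ::
  "real^2 \<Rightarrow> real^2 \<Rightarrow> (real^2) set \<Rightarrow> (real^2 \<Rightarrow> real) \<Rightarrow> real \<Rightarrow> real \<Rightarrow> (real \<Rightarrow> lf_state) \<Rightarrow> bool" where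
  "lf_solution a1 a2 \<Omega> b c T U \<longleftrightarrow>
     (let v = (\<lambda>t. fst (U t)); p = (\<lambda>t. snd (U t));
          vt = (\<lambda>t x. vector_derivative (\<lambda>s. v s x) (at t within {0..T}));
          qt = (\<lambda>t x. vector_derivative (\<lambda>s. lf_discharge b c (v s) x) (at t within {0..T}))
      in (\<forall>x. b x < c) \<and>
         (\<forall>t\<in>{0..T}. periodic a1 a2 (v t) \<and> periodic a1 a2 (p t) \<and> Ck 1 (v t) \<and> Ck 1 (p t)) \<and>
         (\<forall>t\<in>{0..T}. \<forall>x. (\<lambda>s. v s x) differentiable (at t within {0..T})) \<and>
         continuous_on ({0..T} \<times> UNIV) (\<lambda>(t, x). vt t x) \<and>
         (\<forall>i. continuous_on ({0..T} \<times> UNIV) (\<lambda>(t, x). pd i (v t) x)) \<and>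
         (\<forall>i. continuous_on ({0..T} \<times> UNIV) (\<lambda>(t, x). pd i (p t) x)) \<and>
         (\<forall>t\<in>{0..T}. \<forall>x\<in>\<Omega>.
            divg pd (lf_discharge b c (v t)) x = 0 \<and>
            qt t x + divt pd (\<lambda>y. tensor (v t y) (lf_discharge b c (v t) y)) x
              + (c - b x) *\<^sub>R grad pd (p t) x = 0))"

text \<open>
  Residual of the leading order one-step time discretization of this system (explicit flux,
  implicit divergence constraint and surface gradient), normalized by the step length.
\<close>

definition lf_residual ::
  "(real^2 \<Rightarrow> real) \<Rightarrow> real \<Rightarrow> real \<Rightarrow> lf_state \<Rightarrow> lf_state \<Rightarrow> real^2 \<Rightarrow> real \<times> (real^2)" where
  "lf_residual b c dt U U' x =
     (let (v, p) = U; (v', p') = U'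
      in (divg pd (lf_discharge b c v') x,
          (1 / dt) *\<^sub>R (lf_discharge b c v' x - lf_discharge b c v x)
            + divt pd (\<lambda>y. tensor (v y) (lf_discharge b c v y)) x
            + (c - b x) *\<^sub>R grad pd p' x))"

text \<open>
  A one-step method, given by its normalized residual \<open>R\<close>, is consistent with an evolution
  problem, given by its classical solutions \<open>S T\<close> on \<open>[0, T]\<close>, if the truncation error of each
  solution tends to zero with the step length, uniformly in time and space.
\<close>

definition consistent ::
  "(real^2) set \<Rightarrow> (real \<Rightarrow> 's \<Rightarrow> 's \<Rightarrow> real^2 \<Rightarrow> 'r::real_normed_vector) \<Rightarrow>
   (real \<Rightarrow> (real \<Rightarrow> 's) \<Rightarrow> bool) \<Rightarrow> bool" where
  "consistent \<Omega> R S \<longleftrightarrow>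
     (\<forall>T>0. \<forall>U. S T U \<longrightarrow>
        (\<forall>e>0. \<forall>\<^sub>F h in at_right 0.
           \<forall>t\<in>{0..T - h}. \<forall>x\<in>\<Omega>. norm (R h (U t) (U (t + h)) x) < e))"

end

theory Submission
  imports Defs
begin

text \<open>
  In the momentum update the surface gradient carries the weight \<open>dt / \<epsilon>\<^sup>2\<close>, while all other terms have
  no negative power of the Froude number \<open>\<epsilon>\<close>.  Write \<open>H\<close> for the old depth, a prime for the new time
  and a subscript for the order in \<open>\<epsilon>\<close>.  The orders \<open>-2\<close> and \<open>-1\<close> of the momentum update read
  \<open>H\<^sub>0 \<nabla>\<eta>'\<^sub>0 = 0\<close> and \<open>H\<^sub>0 \<nabla>\<eta>'\<^sub>1 + H\<^sub>1 \<nabla>\<eta>'\<^sub>0 = 0\<close>.  As \<open>H\<^sub>0\<close> is positive, both gradients vanish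
  (\<open>scheme_step_gradients\<close>): the new leading order elevation is constant, and order \<open>0\<close> of the update
  is the discrete momentum equation of the limit system, with \<open>\<eta>'\<^sub>2\<close> as its pressure.

  The elevation equation of the scheme arose by inserting the momentum update into the mass equation.
  Undoing this at order \<open>0\<close> gives \<open>\<eta>'\<^sub>0 - \<eta>\<^sub>0 + dt \<nabla>\<cdot>q'\<^sub>0 = 0\<close> (\<open>scheme_step_continuity\<close>).  If \<open>\<eta>\<^sub>0\<close> is
  a constant too, then \<open>\<nabla>\<cdot>q'\<^sub>0\<close> is constant.  A periodic field is bounded, so its flux through the
  boundary of a square of side \<open>R\<close> is of order \<open>R\<close>, whereas a constant divergence \<open>d\<close> integrates to
  \<open>d R\<^sup>2\<close>.  Hence \<open>\<nabla>\<cdot>q'\<^sub>0 = 0\<close>, and the constant elevation does not change from step to step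
  (\<open>scheme_step_elevation_0_conserved\<close>).  The boundary of the domain may be arbitrarily irregular, even
  of positive area, so no integral over the domain itself is taken: identities on the domain
  extend to its closure by continuity and to the plane by periodicity
  (\<open>periodic_constant_extends\<close>), and the squares are taken in the plane.

  For consistency, subtract the exact momentum equation at time \<open>t\<close> from the residual.  What remains,
  up to the depth as a factor, is a difference quotient minus the time derivative, plus the
  increment of the pressure gradient over one step.  Both tend to zero uniformly, because the
  derivatives are uniformly continuous on the product of the time interval and the compact closure
  of the domain
  (\<open>low_froude_residual_consistent\<close>).
\<close>

(* Keeps $ for vector components only. *)
no_notation fps_nth (infixl "$" 75)


section \<open>Calculus of partial derivatives\<close>

lemma pd_eqI:
  assumes "(f has_derivative f') (at x)"
  shows "pd i f x = f' (axis i 1)"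
  using frechet_derivative_at[OF assms] by (simp add: pd_def)

lemma has_real_derivative_along_axis:
  fixes f :: "real^2 \<Rightarrow> real"
  assumes "f differentiable (at (x + s *\<^sub>R axis i 1))"
  shows "((\<lambda>s. f (x + s *\<^sub>R axis i 1)) has_real_derivative pd i f (x + s *\<^sub>R axis i 1)) (at s)"
proof -
  let ?z = "x + s *\<^sub>R axis i 1"
  have "(f has_derivative frechet_derivative f (at ?z)) (at ?z)"
    using assms by (simp only: frechet_derivative_works)
  moreover have "((\<lambda>s. x + s *\<^sub>R axis i 1) has_derivative (\<lambda>s. s *\<^sub>R axis i 1)) (at s)"
    by (auto intro!: derivative_eq_intros)
  ultimately have "((\<lambda>s. f (x + s *\<^sub>R axis i 1)) has_derivative
      (\<lambda>h. frechet_derivative f (at ?z) (h *\<^sub>R axis i 1))) (at s)"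
    by (rule has_derivative_compose[rotated])
  moreover have "frechet_derivative f (at ?z) (h *\<^sub>R axis i 1) = h * pd i f ?z" for h
    using linear_frechet_derivative[OF assms] by (simp add: pd_def linear_scale)
  ultimately show ?thesis by (simp add: has_field_derivative_def mult_commute_abs)
qed

text \<open>
  For functions without a derivative at the point this still holds: the set of possible derivatives,
  from which \<open>frechet_derivative\<close> chooses, depends only on the germ of the function.
\<close>

lemma pd_cong_open:
  assumes "open S" "x \<in> S" and eq: "\<And>y. y \<in> S \<Longrightarrow> f y = g y"
  shows "pd i f x = pd i g x"
proof -
  have "(f has_derivative f') (at x) \<longleftrightarrow> (g has_derivative f') (at x)" for f'
    using has_derivative_transform_within_open[OF _ assms(1,2)] eq by metis
  then show ?thesis by (simp add: pd_def frechet_derivative_def)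
qed

lemma pd_shift:
  assumes "f differentiable (at (x + a))"
  shows "pd i (\<lambda>y. f (y + a)) x = pd i f (x + a)"
proof -
  have "((\<lambda>y. y + a) has_derivative (\<lambda>h. h)) (at x)"
    by (auto intro!: derivative_eq_intros)
  from has_derivative_compose[OF this assms[unfolded frechet_derivative_works]]
  have "((\<lambda>y. f (y + a)) has_derivative frechet_derivative f (at (x + a))) (at x)" .
  from pd_eqI[OF this] show ?thesis by (simp add: pd_def)
qed

lemma pd_const: "pd i (\<lambda>x. c) = (\<lambda>x. 0)"
  by (rule ext, rule pd_eqI, rule has_derivative_const)

lemma pd_add:
  assumes "f differentiable (at x)" "g differentiable (at x)"
  shows "pd i (\<lambda>x. f x + g x) x = pd i f x + pd i g x"
  using pd_eqI[OF has_derivative_add[OF assms[unfolded frechet_derivative_works]]]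
  by (simp only: pd_def)

lemma pd_mult:
  fixes f g :: "real^2 \<Rightarrow> real"
  assumes "f differentiable (at x)" "g differentiable (at x)"
  shows "pd i (\<lambda>x. f x * g x) x = f x * pd i g x + pd i f x * g x"
  using pd_eqI[OF has_derivative_mult[OF assms[unfolded frechet_derivative_works]]]
  by (simp only: pd_def)

lemma pd_nth:
  assumes "f differentiable (at x)"
  shows "pd i (\<lambda>x. f x $ j) x = pd i f x $ j"
  using pd_eqI[OF bounded_linear.has_derivative[OF bounded_linear_vec_nth
        assms[unfolded frechet_derivative_works]]]
  by (simp only: pd_def)

lemma Ck_imp_continuous: "Ck k f \<Longrightarrow> continuous_on UNIV f"
  by (cases k) (simp_all add: continuous_on_eq_continuous_within differentiable_imp_continuous_within)

lemma Ck_SucI: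
  assumes "\<And>x. f differentiable (at x)" "\<And>i. Ck k (pd i f)"
  shows "Ck (Suc k) f"
  using assms by simp

lemma Ck_SucD:
  assumes "Ck (Suc k) f"
  shows "f differentiable (at x)" "Ck k (pd i f)"
  using assms by simp_all

lemma Ck_Suc_imp_Ck: "Ck (Suc k) f \<Longrightarrow> Ck k f"
proof (induction k arbitrary: f)
  case 0
  from Ck_imp_continuous[OF this] show ?case by simp
next
  case (Suc k)
  show ?case
    by (rule Ck_SucI) (rule Ck_SucD[OF Suc.prems], rule Suc.IH, rule Ck_SucD[OF Suc.prems])
qed

lemma Ck_2D:
  assumes "Ck 2 f"
  shows "Ck 1 f" "Ck 1 (pd i f)"
  using Ck_Suc_imp_Ck[of 1 f] Ck_SucD(2)[of 1 f] assms
  by (simp_all only: numeral_2_eq_2 One_nat_def)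

lemma Ck_const: "Ck k (\<lambda>x. c)"
proof (induction k arbitrary: c)
  case (Suc k)
  show ?case by (rule Ck_SucI) (simp_all only: pd_const Suc.IH differentiable_const)
qed simp

lemma Ck_add:
  assumes "Ck k f" "Ck k g"
  shows "Ck k (\<lambda>x. f x + g x)"
  using assms
proof (induction k arbitrary: f g)
  case 0
  then show ?case by (simp add: continuous_on_add)
next
  case (Suc k)
  note D = Ck_SucD[OF Suc.prems(1)] Ck_SucD[OF Suc.prems(2)]
  have "pd i (\<lambda>x. f x + g x) = (\<lambda>x. pd i f x + pd i g x)" for i
    by (rule ext, rule pd_add) (rule D)+
  with Suc.IH[OF D(2) D(4)] D(1,3) show ?case
    by (intro Ck_SucI) (simp_all only: differentiable_add)
qed

lemma Ck_mult:
  fixes f g :: "real^2 \<Rightarrow> real"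
  assumes "Ck k f" "Ck k g"
  shows "Ck k (\<lambda>x. f x * g x)"
  using assms
proof (induction k arbitrary: f g)
  case 0
  then show ?case by (simp add: continuous_on_mult)
next
  case (Suc k)
  note D = Ck_SucD[OF Suc.prems(1)] Ck_SucD[OF Suc.prems(2)]
  have pd: "pd i (\<lambda>x. f x * g x) = (\<lambda>x. f x * pd i g x + pd i f x * g x)" for i
    by (rule ext, rule pd_mult) (rule D)+
  have "Ck k (pd i (\<lambda>x. f x * g x))" for i
    unfolding pd using Suc.prems[THEN Ck_Suc_imp_Ck] D(2,4) by (simp only: Ck_add Suc.IH)
  with D(1,3) show ?case
    by (intro Ck_SucI) (simp_all only: differentiable_mult)
qed

lemma Ck_diff:
  fixes f g :: "real^2 \<Rightarrow> real"
  assumes "Ck k f" "Ck k g"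
  shows "Ck k (\<lambda>x. f x - g x)"
  using Ck_add[OF assms(1) Ck_mult[OF Ck_const[of k "-1"] assms(2)]] by simp

lemma Ck_nth:
  assumes "Ck k f"
  shows "Ck k (\<lambda>x. f x $ j)"
  using assms
proof (induction k arbitrary: f)
  case 0
  then show ?case by (simp add: continuous_on_component)
next
  case (Suc k)
  note D = Ck_SucD[OF Suc.prems]
  have pd: "pd i (\<lambda>x. f x $ j) = (\<lambda>x. pd i f x $ j)" for i
    by (rule ext, rule pd_nth) (rule D)
  show ?case
  proof (rule Ck_SucI)
    show "(\<lambda>x. f x $ j) differentiable (at x)" for x
      using bounded_linear.has_derivative[OF bounded_linear_vec_nth] D(1)[of x]
      unfolding differentiable_def by blast
    show "Ck k (pd i (\<lambda>x. f x $ j))" for i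
      unfolding pd by (rule Suc.IH, rule D)
  qed
qed

lemma Ck_sum:
  fixes f :: "'i \<Rightarrow> real^2 \<Rightarrow> real"
  assumes "\<And>i. i \<in> I \<Longrightarrow> Ck k (f i)" shows "Ck k (\<lambda>x. \<Sum>i\<in>I. f i x)"
  using assms by (induction I rule: infinite_finite_induct) (simp_all add: Ck_const Ck_add)

lemma all_pd_0_imp_constant:
  fixes f :: "real^2 \<Rightarrow> real"
  assumes diff: "\<And>x. f differentiable (at x)" and pd: "\<And>i x. pd i f x = 0"
  shows "f x = f y"
proof (rule has_derivative_zero_unique_connected[of UNIV f])
  fix x
  let ?f' = "frechet_derivative f (at x)"
  have "?f' h = 0" for h
  proof -
    have "h = (\<Sum>i\<in>UNIV. h $ i *\<^sub>R axis i 1)"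
      using basis_expansion[of h] by (simp add: scalar_mult_eq_scaleR)
    then have "?f' h = ?f' (\<Sum>i\<in>UNIV. h $ i *\<^sub>R axis i 1)" by simp
    also have "\<dots> = (\<Sum>i\<in>UNIV. h $ i *\<^sub>R ?f' (axis i 1))"
      using linear_frechet_derivative[OF diff] by (simp add: linear_sum linear_scale)
    also have "\<dots> = 0" using pd by (simp add: pd_def)
    finally show ?thesis .
  qed
  then have "?f' = (\<lambda>h. 0)" by auto
  with diff[of x] show "(f has_derivative (\<lambda>h. 0)) (at x)"
    by (simp add: frechet_derivative_works)
qed auto


section \<open>Periodic fields and constant divergence\<close>

lemma periodic_lattice:
  assumes "periodic a1 a2 f"
  shows "f (x + lattice_vec a1 a2 m n) = f x"
proof -
  have shift: "f (x + of_int k *\<^sub>R a) = f x" if a: "\<And>x. f (x + a) = f x" for a x and k :: int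
  proof (induction k arbitrary: x rule: int_induct[where k = 0])
    case base show ?case by simp
  next
    case (step1 i)
    have "f (x + of_int (i + 1) *\<^sub>R a) = f ((x + of_int i *\<^sub>R a) + a)"
      by (simp add: algebra_simps)
    with step1 a show ?case by simp
  next
    case (step2 i)
    have "f (x + of_int (i - 1) *\<^sub>R a) = f ((x + of_int (i - 1) *\<^sub>R a) + a)"
      using a by simp
    also have "\<dots> = f (x + of_int i *\<^sub>R a)" by (simp add: algebra_simps)
    finally show ?case using step2 by simp
  qed
  have "x + lattice_vec a1 a2 m n = (x + of_int m *\<^sub>R a1) + of_int n *\<^sub>R a2"
    by (simp add: lattice_vec_def add.assoc)
  then show ?thesis
    using shift assms unfolding periodic_def by metis
qed

lemma periodic_value_in_closure:
  assumes "periodic_domain a1 a2 \<Omega>" "periodic a1 a2 f"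
  obtains z where "z \<in> closure \<Omega>" "f x = f z"
proof -
  have "x \<in> (\<Union>m n. (\<lambda>x. x + lattice_vec a1 a2 m n) ` closure \<Omega>)"
    using assms(1) by (simp add: periodic_domain_def)
  then obtain m n z where "z \<in> closure \<Omega>" "x = z + lattice_vec a1 a2 m n" by auto
  then show ?thesis using that periodic_lattice[OF assms(2)] by metis
qed

text \<open>
  The closure of \<open>\<Omega>\<close> represents every value of a periodic field, and continuity carries the
  constant from \<open>\<Omega>\<close> to its closure.  Thus an identity on \<open>\<Omega>\<close> can be used on the whole plane, whatever
  the boundary of \<open>\<Omega>\<close> looks like.
\<close>

lemma periodic_constant_extends:
  fixes f :: "real^2 \<Rightarrow> 'a::t1_space"
  assumes "periodic_domain a1 a2 \<Omega>" "periodic a1 a2 f" "continuous_on UNIV f"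
    and "\<And>x. x \<in> \<Omega> \<Longrightarrow> f x = c"
  shows "f x = c"
proof -
  obtain z where "z \<in> closure \<Omega>" "f x = f z"
    using periodic_value_in_closure[OF assms(1,2)] .
  with continuous_constant_on_closure[of \<Omega> f c] assms(3,4) show ?thesis
    by (metis continuous_on_subset subset_UNIV)
qed

lemma periodic_continuous_bounded:
  fixes f :: "real^2 \<Rightarrow> 'a::real_normed_vector"
  assumes dom: "periodic_domain a1 a2 \<Omega>" and per: "periodic a1 a2 f" and "continuous_on UNIV f"
  obtains M where "\<And>x. norm (f x) \<le> M"
proof -
  have "compact (closure \<Omega>)"
    using dom by (simp add: periodic_domain_def compact_closure)
  then have "bounded (f ` closure \<Omega>)"
    using assms(3) by (meson compact_continuous_image compact_imp_bounded continuous_on_subset subset_UNIV)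
  then obtain M where "\<And>z. z \<in> closure \<Omega> \<Longrightarrow> norm (f z) \<le> M"
    by (auto simp: bounded_iff)
  with that periodic_value_in_closure[OF dom per] show ?thesis by metis
qed

lemma periodic_pd:
  assumes "periodic a1 a2 f" "\<And>x. f differentiable (at x)"
  shows "periodic a1 a2 (pd i f)"
  unfolding periodic_def
proof (intro allI conjI)
  fix x
  show "pd i f (x + a1) = pd i f x" "pd i f (x + a2) = pd i f x"
    using pd_shift[OF assms(2)[of "x + a1"], of i] pd_shift[OF assms(2)[of "x + a2"], of i] assms(1)
    by (simp_all add: periodic_def)
qed

text \<open>
  The divergence theorem on squares of growing side \<open>R\<close>, in a form that avoids double integrals: the
  flux \<open>F s\<close> of the first component through the vertical segment at abscissa \<open>s\<close> has the derivative
  \<open>d R\<close> minus a bounded difference of boundary values of the second component, by differentiation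
  under the integral sign.  The mean value theorem compares this with \<open>\<bar>F R - F 0\<bar> \<le> 2 M R\<close>, so that \<open>\<bar>d\<bar> R \<le> 4 M\<close> for
  every positive \<open>R\<close>.
\<close>

lemma bounded_constant_divergence_eq_0:
  fixes u :: "real^2 \<Rightarrow> real^2"
  assumes C1: "\<And>j. Ck 1 (\<lambda>x. u x $ j)"
    and bound: "\<And>x. norm (u x) \<le> M"
    and div: "\<And>x. divg pd u x = d"
  shows "d = 0"
proof -
  define P :: "real \<Rightarrow> real \<Rightarrow> real^2" where "P s y = s *\<^sub>R axis 1 1 + y *\<^sub>R axis 2 1" for s y
  define D where "D i j s y = pd i (\<lambda>x. u x $ j) (P s y)" for i j s y
  have diff: "(\<lambda>x. u x $ j) differentiable (at x)" and cont_pd: "continuous_on UNIV (pd i (\<lambda>x. u x $ j))"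
    for i j x using C1[of j] by auto
  have D1: "((\<lambda>s. u (P s y) $ j) has_real_derivative D 1 j s y) (at s)" for j s y
    using has_real_derivative_along_axis[where f = "\<lambda>x. u x $ j" and x = "y *\<^sub>R axis 2 1" and s = s
        and i = 1, OF diff]
    by (simp add: P_def D_def add.commute)
  have D2: "((\<lambda>y. u (P s y) $ j) has_real_derivative D 2 j s y) (at y)" for j s y
    using has_real_derivative_along_axis[where f = "\<lambda>x. u x $ j" and x = "s *\<^sub>R axis 1 1" and s = y
        and i = 2, OF diff]
    by (simp add: P_def D_def)
  have sum_D: "D 1 1 s y = d - D 2 2 s y" for s y
    using div[of "P s y"] by (simp add: divg_def sum_2 D_def)
  have abs_u: "\<bar>u x $ j\<bar> \<le> M" for x j
    using component_le_norm_cart[of "u x" j] bound[of x] by linarith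
  have "\<bar>d\<bar> * R \<le> 4 * M" if R: "0 < R" for R
  proof -
    define F where "F s = integral (cbox 0 R) (\<lambda>y. u (P s y) $ 1)" for s
    have cont_P: "continuous_on S (\<lambda>(s, y). P s y)" for S
      unfolding P_def by (auto intro!: continuous_intros simp: split_beta)
    have int_u: "(\<lambda>y. u (P s y) $ 1) integrable_on cbox 0 R" for s
      by (rule integrable_continuous, rule DERIV_continuous_on)
         (rule has_field_derivative_at_within[OF D2])
    have F': "(F has_real_derivative integral (cbox 0 R) (D 1 1 s)) (at s)" for s
      unfolding F_def
    proof (rule leibniz_rule_field_derivative[where U = UNIV and fx = "D 1 1"])
      show "continuous_on (UNIV \<times> cbox 0 R) (\<lambda>(s, y). D 1 1 s y)"
        using continuous_on_compose2[OF cont_pd cont_P subset_UNIV]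
        by (simp add: D_def split_beta)
    qed (use D1 int_u in auto)
    have int_D: "integral (cbox 0 R) (D 1 1 s) = d * R - (u (P s R) $ 2 - u (P s 0) $ 2)" for s
    proof -
      have "(D 2 2 s has_integral u (P s R) $ 2 - u (P s 0) $ 2) (cbox 0 R)"
        using that has_field_derivative_at_within[OF D2]
        by (auto intro!: fundamental_theorem_of_calculus simp flip: has_real_derivative_iff_has_vector_derivative)
      from has_integral_diff[OF has_integral_const_real[of d 0 R] this[unfolded box_real]]
      show ?thesis using that by (simp add: sum_D[abs_def] integral_unique mult.commute)
    qed
    have abs_F: "\<bar>F s\<bar> \<le> M * R" for s
    proof -
      have "norm (F s) \<le> M * (R - 0)"
        unfolding F_def box_real using that abs_u
        by (intro integral_bound) (auto intro!: DERIV_continuous_on has_field_derivative_at_within[OF D2])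
      then show ?thesis using that by simp
    qed
    obtain z where "F R - F 0 = (R - 0) * integral (cbox 0 R) (D 1 1 z)"
      using MVT2[OF R, of F "\<lambda>s. integral (cbox 0 R) (D 1 1 s)"] F' by blast
    then have "F R - F 0 = R * (d * R - (u (P z R) $ 2 - u (P z 0) $ 2))"
      by (simp only: int_D diff_0_right)
    moreover have "\<bar>F R - F 0\<bar> \<le> R * (2 * M)"
      using abs_F[of R] abs_F[of 0] abs_triangle_ineq4[of "F R" "F 0"] by (simp add: algebra_simps)
    ultimately have "R * \<bar>d * R - (u (P z R) $ 2 - u (P z 0) $ 2)\<bar> \<le> R * (2 * M)"
      using R by (simp only: abs_mult abs_of_pos)
    then have "\<bar>d * R - (u (P z R) $ 2 - u (P z 0) $ 2)\<bar> \<le> 2 * M"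
      using R by (simp only: mult_le_cancel_left_pos)
    then have "\<bar>d * R\<bar> \<le> 4 * M" using abs_u[of "P z R" 2] abs_u[of "P z 0" 2] by linarith
    then show ?thesis using that by (simp add: abs_mult)
  qed
  from this[of "(4 * \<bar>M\<bar> + 1) / \<bar>d\<bar>"] show "d = 0"
    by (cases "d = 0") auto
qed


section \<open>Orders of one step of the scheme\<close>

text \<open>
  The orders \<open>-2\<close>, \<open>-1\<close> and \<open>0\<close> of an update with a term of weight \<open>r / \<epsilon>\<^sup>2\<close>; both equations of the
  scheme have this form.
\<close>

lemma laurent_orders_of_singular_update:
  fixes a q D :: "real fps"
  assumes "fps_to_fls a = fps_to_fls q - fls_const r / fls_X^2 * fps_to_fls D"
  shows "r * fps_nth D 0 = 0" "r * fps_nth D 1 = 0" "fps_nth a 0 = fps_nth q 0 - r * fps_nth D 2"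
proof -
  have "fls_X^2 * (fls_const r / fls_X^2 * fps_to_fls D) = fls_const r * fps_to_fls D"
    by (simp only: times_divide_eq_left times_divide_eq_right nonzero_mult_div_cancel_left
        fls_X_pow_nonzero not_False_eq_True)
  then have "fls_X^2 * fps_to_fls a = fls_X^2 * fps_to_fls q - fls_const r * fps_to_fls D"
    unfolding assms right_diff_distrib by simp
  then have "fps_to_fls (fps_X^2 * a) = fps_to_fls (fps_X^2 * q - fps_const r * D)"
    by (simp add: fls_times_fps_to_fls fps_to_fls_power)
  then have eq: "fps_nth (fps_X^2 * a) k = fps_nth (fps_X^2 * q - fps_const r * D) k" for k
    by (simp only: fps_to_fls_eq_iff)
  show "r * fps_nth D 0 = 0" "r * fps_nth D 1 = 0" "fps_nth a 0 = fps_nth q 0 - r * fps_nth D 2"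
    using eq[of 0] eq[of 1] eq[of 2] by (simp_all add: fps_X_power_mult_nth)
qed

lemma coef_depth: "coef k (depth b \<eta>) x = coef k \<eta> x - (if k = 0 then b x else 0)"
  by (simp add: coef_def depth_def)

lemma vcoef_discharge_0: "vcoef 0 (discharge b \<eta> v) x = (coef 0 \<eta> x - b x) *\<^sub>R vcoef 0 v x"
  by (simp add: vec_eq_iff vcoef_def coef_def discharge_def depth_def left_diff_distrib)

lemma fps_nth_divg: "fps_nth (divg fpd u x) k = divg pd (vcoef k u) x"
  by (simp add: divg_def fpd_def fps_sum_nth coef_def[abs_def] vcoef_def[abs_def])

lemma vcoef_explicit_discharge_0:
  "vcoef 0 (explicit_discharge b dt \<eta> v) x =
     vcoef 0 (discharge b \<eta> v) x
       - dt *\<^sub>R divt pd (\<lambda>y. tensor (vcoef 0 v y) (vcoef 0 (discharge b \<eta> v) y)) x"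
  by (simp add: vec_eq_iff vcoef_def explicit_discharge_def divt_def fpd_def fps_sum_nth
      coef_def[abs_def] tensor_def)

lemma vcoef_depth_grad:
  "vcoef k (\<lambda>y. depth b \<eta> y *s grad fpd \<phi> y) x =
     (\<Sum>j=0..k. coef j (depth b \<eta>) x *\<^sub>R grad pd (coef (k - j) \<phi>) x)"
  by (simp add: vec_eq_iff vcoef_def grad_def fps_mult_nth fpd_def coef_def[of _ "depth b \<eta>"])

lemma divg_pd_cong_open:
  assumes "open S" "x \<in> S" "\<And>y. y \<in> S \<Longrightarrow> u y = w y"
  shows "divg pd u x = divg pd w x"
  unfolding divg_def using assms by (intro sum.cong refl pd_cong_open[of S]) auto

lemma divg_pd_add_scaleR:
  fixes u w :: "real^2 \<Rightarrow> real^2"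
  assumes "\<And>i. Ck 1 (\<lambda>x. u x $ i)" "\<And>i. Ck 1 (\<lambda>x. w x $ i)"
  shows "divg pd (\<lambda>y. u y + r *\<^sub>R w y) x = divg pd u x + r * divg pd w x"
proof -
  have D: "(\<lambda>x. u x $ i) differentiable (at x)" "(\<lambda>x. w x $ i) differentiable (at x)" for i x
    using assms[of i] by auto
  have "pd i (\<lambda>y. u y $ i + r * w y $ i) x = pd i (\<lambda>y. u y $ i) x + r * pd i (\<lambda>y. w y $ i) x" for i
    using D[of i] pd_mult[where f = "\<lambda>_. r" and g = "\<lambda>x. w x $ i" and x = x, OF differentiable_const D(2)]
    by (subst pd_add) (auto intro: differentiable_mult simp: pd_const)
  then show ?thesis
    by (simp add: divg_def sum.distrib sum_distrib_left)
qed

lemma scheme_step_orders: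
  assumes step: "scheme_step \<Omega> b dt \<eta> v \<eta>' v'" and "dt \<noteq> 0" and x: "x \<in> \<Omega>"
  defines "g \<equiv> \<lambda>k. vcoef k (\<lambda>y. depth b \<eta> y *s grad fpd \<eta>' y)"
  shows "g 0 x = 0" "g 1 x = 0"
    "vcoef 0 (discharge b \<eta>' v') x = vcoef 0 (explicit_discharge b dt \<eta> v) x - dt *\<^sub>R g 2 x"
    "coef 0 \<eta>' x = coef 0 \<eta> x - dt * divg pd (vcoef 0 (explicit_discharge b dt \<eta> v)) x
       + dt^2 * divg pd (g 2) x"
proof -
  let ?k = "fls_const (dt^2) :: real fls"
  have "fps_to_fls (\<eta>' x) - ?k / fls_X^2
        * fps_to_fls (divg fpd (\<lambda>y. depth b \<eta> y *s grad fpd \<eta>' y) x)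
      = fps_to_fls (\<eta> x) - fls_const dt * fps_to_fls (divg fpd (explicit_discharge b dt \<eta> v) x)"
    using step x unfolding scheme_step_def by blast
  moreover have "fls_const (- (dt^2)) / fls_X^2 = - (?k / fls_X^2)"
    by (simp only: fls_const_uminus minus_divide_left)
  ultimately have "fps_to_fls (\<eta>' x) =
      fps_to_fls (\<eta> x - fps_const dt * divg fpd (explicit_discharge b dt \<eta> v) x)
      - fls_const (- (dt^2)) / fls_X^2
          * fps_to_fls (divg fpd (\<lambda>y. depth b \<eta> y *s grad fpd \<eta>' y) x)"
    by (simp only: diff_eq_eq mult_minus_left diff_minus_eq_add fps_to_fls_minus
        fls_times_fps_to_fls fps_const_to_fls)
  from laurent_orders_of_singular_update(3)[OF this]
  show "coef 0 \<eta>' x = coef 0 \<eta> x - dt * divg pd (vcoef 0 (explicit_discharge b dt \<eta> v)) x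
       + dt^2 * divg pd (g 2) x"
    by (simp add: coef_def fps_nth_divg g_def)
  have mom: "fps_to_fls (discharge b \<eta>' v' x $ i) = fps_to_fls (explicit_discharge b dt \<eta> v x $ i)
      - fls_const dt / fls_X^2 * fps_to_fls ((depth b \<eta> x *s grad fpd \<eta>' x) $ i)" for i
  proof -
    have "vec_to_fls (discharge b \<eta>' v' x) $ i = (vec_to_fls (explicit_discharge b dt \<eta> v x)
            - (fls_const dt / fls_X^2) *s vec_to_fls (depth b \<eta> x *s grad fpd \<eta>' x)) $ i"
      using step x unfolding scheme_step_def by metis
    then show ?thesis
      by (simp only: vec_to_fls_def vec_lambda_beta vector_minus_component vector_smult_component)
  qed
  note orders = laurent_orders_of_singular_update[OF mom]
  show "g 0 x = 0" "g 1 x = 0"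
    using orders(1,2) \<open>dt \<noteq> 0\<close> by (simp_all add: g_def vcoef_def vec_eq_iff)
  show "vcoef 0 (discharge b \<eta>' v') x = vcoef 0 (explicit_discharge b dt \<eta> v) x - dt *\<^sub>R g 2 x"
    using orders(3) by (simp add: g_def vcoef_def vec_eq_iff)
qed

text \<open>
  At order \<open>k\<close> the product of depth and surface gradient is a convolution.  The positive leading order
  depth makes the two singular orders solvable one after the other, and only one summand of the
  second order survives.
\<close>

lemma scheme_step_gradients:
  assumes step: "scheme_step \<Omega> b dt \<eta> v \<eta>' v'" and "dt \<noteq> 0" and x: "x \<in> \<Omega>"
    and wet: "0 < coef 0 (depth b \<eta>) x"
  shows "grad pd (coef 0 \<eta>') x = 0"
    "vcoef 2 (\<lambda>y. depth b \<eta> y *s grad fpd \<eta>' y) x =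
       coef 0 (depth b \<eta>) x *\<^sub>R grad pd (coef 2 \<eta>') x"
proof -
  show 0: "grad pd (coef 0 \<eta>') x = 0"
    using scheme_step_orders(1)[OF assms(1-3)] wet by (simp add: vcoef_depth_grad)
  then have "grad pd (coef 1 \<eta>') x = 0"
    using scheme_step_orders(2)[OF assms(1-3)] wet by (simp add: vcoef_depth_grad)
  with 0 show "vcoef 2 (\<lambda>y. depth b \<eta> y *s grad fpd \<eta>' y) x =
       coef 0 (depth b \<eta>) x *\<^sub>R grad pd (coef 2 \<eta>') x"
    by (simp add: vcoef_depth_grad numeral_2_eq_2)
qed

lemma Ck_discharge_0:
  assumes "Ck k b" "Ck k (coef 0 \<eta>)" "Ck k (vcoef 0 v)"
  shows "Ck k (\<lambda>x. vcoef 0 (discharge b \<eta> v) x $ i)"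
  unfolding vcoef_discharge_0 using assms by (simp add: Ck_mult Ck_diff Ck_nth)

lemma Ck_coef_depth:
  assumes "Ck k b" "Ck k (coef j \<eta>)"
  shows "Ck k (coef j (depth b \<eta>))"
proof -
  have "coef j (depth b \<eta>) = (\<lambda>x. coef j \<eta> x - (if j = 0 then b x else 0))"
    by (rule ext) (rule coef_depth)
  then show ?thesis using assms by (cases "j = 0") (simp_all add: Ck_diff)
qed

text \<open>
  The second order of the product of depth and surface gradient enters the momentum update with
  weight \<open>- dt\<close>, and its divergence enters the elevation equation with weight \<open>dt\<^sup>2\<close>.  Hence \<open>dt\<close> times
  the divergence of the momentum update eliminates it from the elevation equation.  What is left is
  the mass equation with the implicit discharge.
\<close>

lemma scheme_step_continuity:
  assumes step: "scheme_step \<Omega> b dt \<eta> v \<eta>' v'" and "dt \<noteq> 0" and "open \<Omega>" and x: "x \<in> \<Omega>"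
    and b: "Ck 2 b" and \<eta>: "\<And>k. Ck 2 (coef k \<eta>)" and \<eta>': "\<And>k. Ck 2 (coef k \<eta>')"
    and v': "Ck 2 (vcoef 0 v')"
  shows "coef 0 \<eta>' x - coef 0 \<eta> x + dt * divg pd (vcoef 0 (discharge b \<eta>' v')) x = 0"
proof -
  let ?q' = "vcoef 0 (discharge b \<eta>' v')" and ?q = "vcoef 0 (explicit_discharge b dt \<eta> v)"
    and ?g = "vcoef 2 (\<lambda>y. depth b \<eta> y *s grad fpd \<eta>' y)"
  have C1_g: "Ck 1 (\<lambda>x. ?g x $ i)" for i
  proof -
    have "?g x $ i = (\<Sum>j=0..2. coef j (depth b \<eta>) x * pd i (coef (2 - j) \<eta>') x)" for x
      by (simp add: vcoef_depth_grad) (simp add: grad_def)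
    moreover have "Ck 1 (\<lambda>x. coef j (depth b \<eta>) x * pd i (coef (2 - j) \<eta>') x)" for j
      by (rule Ck_mult[OF Ck_2D(1)[OF Ck_coef_depth[OF b \<eta>]] Ck_2D(2)[OF \<eta>']])
    ultimately show ?thesis by (simp only: Ck_sum)
  qed
  have C1_q': "Ck 1 (\<lambda>x. ?q' x $ i)" for i
    by (rule Ck_2D(1)[OF Ck_discharge_0[OF b \<eta>' v']])
  have "divg pd ?q x = divg pd (\<lambda>y. ?q' y + dt *\<^sub>R ?g y) x"
    by (rule divg_pd_cong_open[OF \<open>open \<Omega>\<close> x])
       (simp add: scheme_step_orders(3)[OF step \<open>dt \<noteq> 0\<close>])
  also have "\<dots> = divg pd ?q' x + dt * divg pd ?g x"
    using C1_q' C1_g by (rule divg_pd_add_scaleR)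
  finally show ?thesis
    using scheme_step_orders(4)[OF step \<open>dt \<noteq> 0\<close> x] by (simp add: algebra_simps power2_eq_square)
qed


section \<open>The limit of the scheme at leading order\<close>

lemma periodic_coef: "periodic a1 a2 \<phi> \<Longrightarrow> periodic a1 a2 (coef k \<phi>)"
  by (simp add: periodic_def coef_def)

lemma periodic_discharge_0:
  assumes "periodic a1 a2 b" "periodic a1 a2 \<eta>" "periodic a1 a2 v"
  shows "periodic a1 a2 (vcoef 0 (discharge b \<eta> v))"
  using assms by (simp add: periodic_def vcoef_def discharge_def depth_def)

text \<open>
  The momentum update makes the gradient vanish on \<open>\<Omega>\<close>.  It is carried over to the plane before the
  elevation is concluded to be constant, because the discharge is needed with one and the same
  constant at every point of the plane.
\<close>

lemma scheme_step_elevation_0_constant: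
  assumes dom: "periodic_domain a1 a2 \<Omega>" and step: "scheme_step \<Omega> b dt \<eta> v \<eta>' v'" and "dt \<noteq> 0"
    and wet: "\<And>x. 0 < coef 0 (depth b \<eta>) x"
    and per: "periodic a1 a2 \<eta>'" and C1: "Ck 1 (coef 0 \<eta>')"
  shows "coef 0 \<eta>' x = coef 0 \<eta>' y"
proof (rule all_pd_0_imp_constant)
  show diff: "coef 0 \<eta>' differentiable (at x)" for x using C1 by simp
  show "pd i (coef 0 \<eta>') x = 0" for i x
  proof (rule periodic_constant_extends[OF dom])
    show "periodic a1 a2 (pd i (coef 0 \<eta>'))"
      using periodic_coef[OF per] diff by (rule periodic_pd)
    show "continuous_on UNIV (pd i (coef 0 \<eta>'))" using C1 by simp
    show "pd i (coef 0 \<eta>') z = 0" if "z \<in> \<Omega>" for z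
      using scheme_step_gradients(1)[OF step \<open>dt \<noteq> 0\<close> that wet] by (simp add: grad_def vec_eq_iff)
  qed
qed

text \<open>
  By \<open>scheme_step_continuity\<close> the discharge has the constant divergence \<open>(c - c') / dt\<close> on \<open>\<Omega>\<close>, hence
  on the plane, and a constant divergence of a periodic field is zero.
\<close>

lemma scheme_step_elevation_0_conserved:
  assumes dom: "periodic_domain a1 a2 \<Omega>" and step: "scheme_step \<Omega> b dt \<eta> v \<eta>' v'" and "dt \<noteq> 0"
    and b: "periodic a1 a2 b" "Ck 2 b"
    and \<eta>: "\<And>k. Ck 2 (coef k \<eta>)" and \<eta>': "periodic a1 a2 \<eta>'" "\<And>k. Ck 2 (coef k \<eta>')"
    and v': "periodic a1 a2 v'" "Ck 2 (vcoef 0 v')"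
    and c: "\<And>x. coef 0 \<eta> x = c" and c': "\<And>x. coef 0 \<eta>' x = c'"
  shows "c' = c" "divg pd (vcoef 0 (discharge b \<eta>' v')) x = 0"
proof -
  let ?q' = "vcoef 0 (discharge b \<eta>' v')"
  have "open \<Omega>" using dom by (simp add: periodic_domain_def)
  have C1_q': "Ck 1 (\<lambda>x. ?q' x $ i)" for i
    by (rule Ck_2D(1)[OF Ck_discharge_0[OF b(2) \<eta>'(2) v'(2)]])
  have per_q': "periodic a1 a2 ?q'"
    using b(1) \<eta>'(1) v'(1) by (rule periodic_discharge_0)
  have "divg pd ?q' x = (c - c') / dt" for x
  proof (rule periodic_constant_extends[OF dom])
    have "periodic a1 a2 (pd i (\<lambda>y. ?q' y $ i))" for i
      using per_q' C1_q'[of i] by (intro periodic_pd) (simp_all add: periodic_def)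
    then show "periodic a1 a2 (divg pd ?q')"
      by (simp add: periodic_def divg_def)
    show "continuous_on UNIV (divg pd ?q')"
      unfolding divg_def[abs_def] using C1_q' by (intro continuous_on_sum) simp
    show "divg pd ?q' z = (c - c') / dt" if "z \<in> \<Omega>" for z
      using scheme_step_continuity[OF step \<open>dt \<noteq> 0\<close> \<open>open \<Omega>\<close> that b(2) \<eta> \<eta>'(2) v'(2)] c c' \<open>dt \<noteq> 0\<close>
      by (simp add: field_simps)
  qed
  moreover have "continuous_on UNIV ?q'"
    unfolding vcoef_discharge_0[abs_def] using b(2) \<eta>'(2) v'(2)
    by (intro continuous_intros Ck_imp_continuous)
  then obtain M where "\<And>x. norm (?q' x) \<le> M"
    using periodic_continuous_bounded[OF dom per_q'] by metis
  ultimately have "(c - c') / dt = 0" and div: "divg pd ?q' x = (c - c') / dt"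
    using bounded_constant_divergence_eq_0[OF C1_q'] by metis+
  then show "c' = c" "divg pd ?q' x = 0" using \<open>dt \<noteq> 0\<close> by simp_all
qed

text \<open>
  The first component is the divergence constraint just obtained; the second is order \<open>0\<close> of the
  momentum update, divided by \<open>dt\<close>.
\<close>

lemma scheme_step_lf_residual_eq_0:
  assumes dom: "periodic_domain a1 a2 \<Omega>" and step: "scheme_step \<Omega> b dt \<eta> v \<eta>' v'" and "dt \<noteq> 0"
    and wet: "\<And>x. 0 < coef 0 (depth b \<eta>) x"
    and b: "periodic a1 a2 b" "Ck 2 b"
    and \<eta>: "\<And>k. Ck 2 (coef k \<eta>)" and \<eta>': "periodic a1 a2 \<eta>'" "\<And>k. Ck 2 (coef k \<eta>')"
    and v': "periodic a1 a2 v'" "Ck 2 (vcoef 0 v')"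
    and c: "\<And>x. coef 0 \<eta> x = c" and c': "\<And>x. coef 0 \<eta>' x = c" and x: "x \<in> \<Omega>"
  shows "lf_residual b c dt (vcoef 0 v, coef 2 \<eta>) (vcoef 0 v', coef 2 \<eta>') x = 0"
proof -
  have q: "vcoef 0 (discharge b \<eta> v) = lf_discharge b c (vcoef 0 v)"
    and q': "vcoef 0 (discharge b \<eta>' v') = lf_discharge b c (vcoef 0 v')"
    by (simp_all add: fun_eq_iff vcoef_discharge_0 lf_discharge_def c c')
  have "divg pd (lf_discharge b c (vcoef 0 v')) x = 0"
    using scheme_step_elevation_0_conserved(2)[OF dom step \<open>dt \<noteq> 0\<close> b \<eta> \<eta>' v' c c'] by (simp add: q')
  moreover
  let ?F = "divt pd (\<lambda>y. tensor (vcoef 0 v y) (lf_discharge b c (vcoef 0 v) y)) x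
    + (c - b x) *\<^sub>R grad pd (coef 2 \<eta>') x"
  have "lf_discharge b c (vcoef 0 v') x - lf_discharge b c (vcoef 0 v) x = - (dt *\<^sub>R ?F)"
    using scheme_step_orders(3)[OF step \<open>dt \<noteq> 0\<close> x]
      scheme_step_gradients(2)[OF step \<open>dt \<noteq> 0\<close> x wet]
    by (simp add: vcoef_explicit_discharge_0 q q' coef_depth c scaleR_right_distrib)
  then have "(1 / dt) *\<^sub>R (lf_discharge b c (vcoef 0 v') x - lf_discharge b c (vcoef 0 v) x) = - ?F"
    using \<open>dt \<noteq> 0\<close> by simp
  ultimately show ?thesis
    by (simp add: lf_residual_def zero_prod_def)
qed


section \<open>Truncation error of the limit scheme\<close>

lemma uniformly_continuous_in_time:
  fixes f :: "real \<Rightarrow> 'a::metric_space \<Rightarrow> 'b::real_normed_vector"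
  assumes cont: "continuous_on ({0..T} \<times> UNIV) (\<lambda>(t, x). f t x)" and K: "compact K" and "0 < e"
  obtains d where "0 < d"
    "\<And>s t x. s \<in> {0..T} \<Longrightarrow> t \<in> {0..T} \<Longrightarrow> x \<in> K \<Longrightarrow> \<bar>s - t\<bar> < d \<Longrightarrow> norm (f s x - f t x) < e"
proof -
  have "continuous_on ({0..T} \<times> K) (\<lambda>(t, x). f t x)"
    using cont by (rule continuous_on_subset) auto
  moreover have "compact ({0..T} \<times> K)"
    using K by (simp add: compact_Times)
  ultimately have "uniformly_continuous_on ({0..T} \<times> K) (\<lambda>(t, x). f t x)"
    by (rule compact_uniformly_continuous)
  then obtain d where "0 < d" and d: "\<And>p q. p \<in> {0..T} \<times> K \<Longrightarrow> q \<in> {0..T} \<times> K \<Longrightarrow> dist q p < d \<Longrightarrow>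
      dist (case q of (t, x) \<Rightarrow> f t x) (case p of (t, x) \<Rightarrow> f t x) < e"
    using \<open>0 < e\<close> unfolding uniformly_continuous_on_def by metis
  have "norm (f s x - f t x) < e"
    if "s \<in> {0..T}" "t \<in> {0..T}" "x \<in> K" "\<bar>s - t\<bar> < d" for s t x
    using d[of "(t, x)" "(s, x)"] that by (simp add: dist_Pair_Pair dist_norm)
  with \<open>0 < d\<close> show ?thesis by (rule that)
qed

text \<open>
  The divergence constraint holds exactly at time \<open>t + h\<close>, so only the momentum residual matters.
  By the momentum equation at time \<open>t\<close> it equals the depth times \<open>A + B\<close>, where \<open>A\<close> is the error of
  the difference quotient of \<open>v\<close> (the depth does not depend on time) and \<open>B\<close> is the increment of
  the pressure gradient.  The mean value inequality bounds \<open>A\<close> by the oscillation of the time derivative over one step.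
\<close>

lemma low_froude_residual_consistent:
  assumes "bounded \<Omega>" "continuous_on UNIV b"
  shows "consistent \<Omega> (lf_residual b c) (lf_solution a1 a2 \<Omega> b c)"
  unfolding consistent_def
proof (intro allI impI)
  fix T e :: real and U :: "real \<Rightarrow> lf_state"
  assume "0 < T" "0 < e" and sol: "lf_solution a1 a2 \<Omega> b c T U"
  define v where "v t = fst (U t)" for t
  define p where "p t = snd (U t)" for t
  define vt where "vt t x = vector_derivative (\<lambda>s. v s x) (at t within {0..T})" for t x
  define qt where "qt t x = vector_derivative (\<lambda>s. lf_discharge b c (v s) x) (at t within {0..T})"
    for t x
  note sol' = sol[unfolded lf_solution_def Let_def, folded v_def p_def, folded vt_def qt_def]
  have v_diff: "(\<lambda>s. v s x) differentiable (at t within {0..T})" if "t \<in> {0..T}" for t x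
    using sol' that by blast
  have vt_cont: "continuous_on ({0..T} \<times> UNIV) (\<lambda>(t, x). vt t x)"
    and p_cont: "continuous_on ({0..T} \<times> UNIV) (\<lambda>(t, x). pd i (p t) x)" for i
    using sol' by blast+
  have div_eq: "divg pd (lf_discharge b c (v t)) x = 0"
    and mom_eq: "qt t x + divt pd (\<lambda>y. tensor (v t y) (lf_discharge b c (v t) y)) x
      + (c - b x) *\<^sub>R grad pd (p t) x = 0" if "t \<in> {0..T}" "x \<in> \<Omega>" for t x
    using sol' that by blast+
  have vt_deriv: "((\<lambda>s. v s x) has_vector_derivative vt t x) (at t within {0..T})"
    if "t \<in> {0..T}" for t x
    using v_diff[OF that] unfolding vt_def by (simp add: vector_derivative_works)
  have qt_eq: "qt t x = (c - b x) *\<^sub>R vt t x" if "t \<in> {0..T}" for t x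
    unfolding qt_def lf_discharge_def
    by (rule vector_derivative_within_closed_interval[OF \<open>0 < T\<close> that],
        rule bounded_linear.has_vector_derivative[OF bounded_linear_scaleR_right vt_deriv[OF that]])
  have K: "compact (closure \<Omega>)"
    using assms(1) by (simp add: compact_closure)
  have "bounded ((\<lambda>x. c - b x) ` closure \<Omega>)"
    by (intro compact_imp_bounded compact_continuous_image K continuous_on_diff continuous_on_const
        continuous_on_subset[OF assms(2)] subset_UNIV)
  then obtain M where "0 < M" and M: "\<And>x. x \<in> closure \<Omega> \<Longrightarrow> \<bar>c - b x\<bar> \<le> M"
    unfolding bounded_pos by auto
  \<comment> \<open>The residual collects one error from the time derivative and one from each of the two
    components of the gradient, all multiplied by the depth.\<close>
  define tol where "tol = e / (4 * M)"
  have "0 < tol" using \<open>0 < e\<close> \<open>0 < M\<close> by (simp add: tol_def)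
  obtain d0 where "0 < d0" and d0: "\<And>s t x. s \<in> {0..T} \<Longrightarrow> t \<in> {0..T} \<Longrightarrow> x \<in> closure \<Omega> \<Longrightarrow>
      \<bar>s - t\<bar> < d0 \<Longrightarrow> norm (vt s x - vt t x) < tol"
    using uniformly_continuous_in_time[OF vt_cont K \<open>0 < tol\<close>] by metis
  have "\<forall>i. \<exists>d>0. \<forall>s\<in>{0..T}. \<forall>t\<in>{0..T}. \<forall>x\<in>closure \<Omega>. \<bar>s - t\<bar> < d \<longrightarrow>
      norm (pd i (p s) x - pd i (p t) x) < tol"
    using uniformly_continuous_in_time[OF p_cont K \<open>0 < tol\<close>] by metis
  then obtain d where d_pos: "\<And>i. 0 < d i" and d: "\<And>i s t x. s \<in> {0..T} \<Longrightarrow> t \<in> {0..T} \<Longrightarrow>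
      x \<in> closure \<Omega> \<Longrightarrow> \<bar>s - t\<bar> < d i \<Longrightarrow> norm (pd i (p s) x - pd i (p t) x) < tol"
    by metis
  define \<delta> where "\<delta> = min d0 (min (d 1) (d 2))"
  have "norm (lf_residual b c h (U t) (U (t + h)) x) < e"
    if h: "h \<in> {0<..<\<delta>}" and t: "t \<in> {0..T - h}" and x: "x \<in> \<Omega>" for h t x
  proof -
    have times: "t \<in> {0..T}" "t + h \<in> {0..T}" "0 < h" and sub: "{t..t + h} \<subseteq> {0..T}"
      using h t by auto
    have xK: "x \<in> closure \<Omega>" using x closure_subset by blast
    define A where "A = (1 / h) *\<^sub>R (v (t + h) x - v t x) - vt t x"
    define B where "B = grad pd (p (t + h)) x - grad pd (p t) x"
    have "norm (v (t + h) x - v t x - (t + h - t) *\<^sub>R vt t x) \<le> norm (t + h - t) * tol"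
    proof (rule vector_differentiable_bound_linearization[where S = "{t..t + h}"])
      show "((\<lambda>s. v s x) has_vector_derivative vt s x) (at s within {t..t + h})"
        if "s \<in> {t..t + h}" for s
        using that sub by (intro has_vector_derivative_within_subset[OF vt_deriv]) auto
      show "norm (vt s x - vt t x) \<le> tol" if "s \<in> {t..t + h}" for s
        using d0[of s t x] that sub times(1) xK h by (intro less_imp_le) (auto simp: \<delta>_def)
    qed (use times(3) in \<open>auto simp: closed_segment_eq_real_ivl\<close>)
    then have "norm (h *\<^sub>R A) \<le> h * tol"
      using times(3) by (simp add: A_def algebra_simps)
    then have A: "norm A \<le> tol" using times(3) by simp
    have B_comp: "\<bar>B $ i\<bar> < tol" for i
    proof -
      have "i = 1 \<or> i = 2" by (rule exhaust_2)
      then have "\<bar>(t + h) - t\<bar> < d i" using h by (auto simp: \<delta>_def)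
      from d[OF times(2,1) xK this] show ?thesis by (simp add: B_def grad_def)
    qed
    have B: "norm B \<le> 2 * tol"
      using norm_le_l1_cart[of B] B_comp[of 1] B_comp[of 2] by (simp add: sum_2)
    have "lf_residual b c h (U t) (U (t + h)) x = (0, (c - b x) *\<^sub>R (A + B))"
      using div_eq[OF times(2) x] mom_eq[OF times(1) x] qt_eq[OF times(1)]
      unfolding lf_residual_def case_prod_unfold Let_def v_def[symmetric] p_def[symmetric]
      by (simp add: A_def B_def lf_discharge_def algebra_simps)
    then have "norm (lf_residual b c h (U t) (U (t + h)) x) = \<bar>c - b x\<bar> * norm (A + B)"
      by (simp add: norm_Pair)
    also have "\<dots> \<le> M * (3 * tol)"
      using A B norm_triangle_ineq[of A B] M[OF xK] \<open>0 < M\<close> by (intro mult_mono) auto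
    also have "\<dots> < e" using \<open>0 < e\<close> \<open>0 < M\<close> by (simp add: tol_def)
    finally show ?thesis .
  qed
  moreover have "0 < \<delta>" using \<open>0 < d0\<close> d_pos by (simp add: \<delta>_def)
  ultimately show "\<forall>\<^sub>F h in at_right 0. \<forall>t\<in>{0..T - h}. \<forall>x\<in>\<Omega>.
      norm (lf_residual b c h (U t) (U (t + h)) x) < e"
    by (intro eventually_at_rightI[of 0 \<delta>]) blast+
qed


section \<open>The asymptotic-preserving property\<close>

theorem theorem2:
  fixes a1 a2 :: "real^2" and \<Omega> :: "(real^2) set" and b :: "real^2 \<Rightarrow> real"
    and N :: nat and t :: "nat \<Rightarrow> real"
    and \<eta> :: "nat \<Rightarrow> real^2 \<Rightarrow> real fps" and v :: "nat \<Rightarrow> real^2 \<Rightarrow> real fps ^ 2"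
  assumes domain: "periodic_domain a1 a2 \<Omega>"
    and bathymetry: "periodic a1 a2 b" "Ck 2 b"
    and times: "\<And>n. n < N \<Longrightarrow> t n < t (Suc n)"
    and periodic_fields: "\<And>n. n \<le> N \<Longrightarrow> periodic a1 a2 (\<eta> n)" "\<And>n. n \<le> N \<Longrightarrow> periodic a1 a2 (v n)"
    and regular_fields: "\<And>n k. n \<le> N \<Longrightarrow> Ck 2 (coef k (\<eta> n))"
      "\<And>n k. n \<le> N \<Longrightarrow> Ck 2 (vcoef k (v n))"
    and no_dry_areas: "\<And>n x. n \<le> N \<Longrightarrow> 0 < coef 0 (depth b (\<eta> n)) x"
    and scheme: "\<And>n. n < N \<Longrightarrow>
      scheme_step \<Omega> b (t (Suc n) - t n) (\<eta> n) (v n) (\<eta> (Suc n)) (v (Suc n))"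
  shows "(\<exists>c. \<forall>n\<le>N. 0 < n \<or> coef 0 (\<eta> 0) constant_on \<Omega> \<longrightarrow>
            (\<forall>x\<in>\<Omega>. coef 0 (\<eta> n) x = c \<and>
              vcoef 0 (discharge b (\<eta> n) (v n)) x = lf_discharge b c (vcoef 0 (v n)) x) \<and>
            (n < N \<longrightarrow> (\<forall>x\<in>\<Omega>.
              lf_residual b c (t (Suc n) - t n)
                (vcoef 0 (v n), coef 2 (\<eta> n)) (vcoef 0 (v (Suc n)), coef 2 (\<eta> (Suc n))) x = 0)))
       \<and> (\<forall>c. consistent \<Omega> (lf_residual b c) (lf_solution a1 a2 \<Omega> b c))"
proof -
  have dt: "t (Suc n) - t n \<noteq> 0" if "n < N" for n
    using times[OF that] by simp
  have C1: "Ck 1 (coef 0 (\<eta> n))" if "n \<le> N" for n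
    by (rule Ck_2D(1)[OF regular_fields(1)[OF that]])
  have const_Suc: "coef 0 (\<eta> (Suc n)) x = coef 0 (\<eta> (Suc n)) y" if n: "n < N" for n x y
    using n by (intro scheme_step_elevation_0_constant[OF domain scheme[OF n] dt[OF n]] no_dry_areas
        periodic_fields(1) C1) simp_all
  have conserved: "coef 0 (\<eta> (Suc n)) x = c" if n: "n < N" and c: "\<And>x. coef 0 (\<eta> n) x = c" for n x c
  proof -
    have "n \<le> N" "Suc n \<le> N" using n by simp_all
    from scheme_step_elevation_0_conserved(1)[OF domain scheme[OF n] dt[OF n] bathymetry
        regular_fields(1) periodic_fields(1) regular_fields(1) periodic_fields(2) regular_fields(2)
        c const_Suc[OF n], OF this(1,2,2,2,2)]
    show ?thesis .
  qed
  have initial: "coef 0 (\<eta> 0) x = coef 0 (\<eta> 0) y" if "coef 0 (\<eta> 0) constant_on \<Omega>" for x y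
  proof -
    from that obtain a where "\<And>z. z \<in> \<Omega> \<Longrightarrow> coef 0 (\<eta> 0) z = a"
      by (auto simp: constant_on_def)
    from periodic_constant_extends[OF domain periodic_coef[OF periodic_fields(1)] _ this]
    show ?thesis using Ck_imp_continuous[OF C1[of 0]] by simp
  qed
  \<comment> \<open>Two starting points, because a non-constant initial leading order elevation becomes constant
    only in the first step.\<close>
  define m where "m = (if coef 0 (\<eta> 0) constant_on \<Omega> then 0 else Suc 0)"
  define c where "c = coef 0 (\<eta> m) 0"
  have elevation: "coef 0 (\<eta> n) x = c" if "m \<le> n" "n \<le> N" for n x
    using that
  proof (induction n arbitrary: x rule: dec_induct)
    case base
    then show ?case
      using initial[of x 0] const_Suc[of 0 x 0] by (auto simp: m_def c_def split: if_splits)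
  next
    case (step n)
    then show ?case using conserved[of n c x] by simp
  qed
  have "(\<forall>x\<in>\<Omega>. coef 0 (\<eta> n) x = c \<and>
              vcoef 0 (discharge b (\<eta> n) (v n)) x = lf_discharge b c (vcoef 0 (v n)) x) \<and>
            (n < N \<longrightarrow> (\<forall>x\<in>\<Omega>.
              lf_residual b c (t (Suc n) - t n)
                (vcoef 0 (v n), coef 2 (\<eta> n)) (vcoef 0 (v (Suc n)), coef 2 (\<eta> (Suc n))) x = 0))"
    if "n \<le> N" "0 < n \<or> coef 0 (\<eta> 0) constant_on \<Omega>" for n
  proof -
    have "m \<le> n" using that(2) by (auto simp: m_def)
    note c = elevation[OF this that(1)]
    have "lf_residual b c (t (Suc n) - t n)
        (vcoef 0 (v n), coef 2 (\<eta> n)) (vcoef 0 (v (Suc n)), coef 2 (\<eta> (Suc n))) x = 0"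
      if n: "n < N" and x: "x \<in> \<Omega>" for x
    proof (rule scheme_step_lf_residual_eq_0[OF domain scheme[OF n] dt[OF n] _ bathymetry])
      show "coef 0 (\<eta> (Suc n)) x = c" for x
        using elevation[of "Suc n" x] \<open>m \<le> n\<close> n by simp
    qed (use n in \<open>simp_all add: no_dry_areas periodic_fields regular_fields c x\<close>)
    then show ?thesis
      using c by (simp add: vcoef_discharge_0 lf_discharge_def)
  qed
  moreover have "consistent \<Omega> (lf_residual b c) (lf_solution a1 a2 \<Omega> b c)" for c
    using domain Ck_imp_continuous[OF bathymetry(2)]
    by (intro low_froude_residual_consistent) (simp_all add: periodic_domain_def)
  ultimately show ?thesis by blast
qed

end
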